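(* Let $\mathbb F$ be a field, $d\ge1$ an integer, $A=A(d,\mathbb F)$. For every integer $n\ge1$ the space $A_{\ge n}=A_n+A_{n+1}+\cdots$ is a 2-sided ideal of $A$.
   Context: Algebras are associative and have a $1$. For a field $\mathbb F$ and an integer $d\ge 1$, $A=A(d,\mathbb F)$ is the $\mathbb F$-algebra defined by generators $\{e_i\}_{i=0}^d$, $\{e^*_i\}_{i=0}^d$ and relations $e_ie_j=\delta_{i,j}e_i$, $e^*_ie^*_j=\delta_{i,j}e^*_i$ $(0\le i,j\le d)$, $1=\sum_{i=0}^d e_i$, $1=\sum_{i=0}^d e^*_i$. The $e_i,e_i^*$ are the idempotent generators; the $e^*_i$ are called starred and the $e_i$ nonstarred; $i$ is the index of $e_i$ and of $e^*_i$. For $n\ge1$, a word of length $n$ in $A$ is a product $g_1g_2\cdots g_n$ of idempotent generators such that for $2\le j\le n$ exactly one of $g_{j-1},g_j$ is starred. It ends with $g_n$. The word is nonrepeating (NR) if $g_{j-1},g_j$ have different indices for $2\le j\le n$. For $n\ge1$, $A_n$ is the subspace of $A$ spanned by the NR words that have length $n$ and end with a nonstarred element. *)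

theory Defs
  imports "HOL-Algebra.QuotRing" "HOL-Algebra.Module"
begin

section \<open>Free algebras, quotient algebras, spans\<close>

text \<open>
  The free associative unital algebra over \<open>F\<close> on the set \<open>S\<close>: finitely supported functions
  from the lists over \<open>S\<close> to \<open>F\<close>, extended by zero to all lists.  The lists are the monomials,
  multiplied by concatenation, so that the coefficient of \<open>w\<close> in a product is a sum over the
  ways to split \<open>w\<close>.  The record type is the library's module record, which adds a scalar
  multiplication to the ring operations.
\<close>

definition free_algebra ::
    "('a, 'm) ring_scheme \<Rightarrow> 'g set \<Rightarrow> ('a, 'g list \<Rightarrow> 'a) module" where
  "free_algebra F S =
    \<lparr>carrier = {f. (\<forall>w. f w \<in> carrier F) \<and> finite {w. f w \<noteq> \<zero>\<^bsub>F\<^esub>}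
                  \<and> (\<forall>w. f w \<noteq> \<zero>\<^bsub>F\<^esub> \<longrightarrow> set w \<subseteq> S)},
     mult = (\<lambda>f g w. \<Oplus>\<^bsub>F\<^esub>i\<in>{..length w}. f (take i w) \<otimes>\<^bsub>F\<^esub> g (drop i w)),
     one = (\<lambda>w. if w = [] then \<one>\<^bsub>F\<^esub> else \<zero>\<^bsub>F\<^esub>),
     zero = (\<lambda>w. \<zero>\<^bsub>F\<^esub>),
     add = (\<lambda>f g w. f w \<oplus>\<^bsub>F\<^esub> g w),
     smult = (\<lambda>c f w. c \<otimes>\<^bsub>F\<^esub> f w)\<rparr>"

definition free_gen :: "('a, 'm) ring_scheme \<Rightarrow> 'g \<Rightarrow> 'g list \<Rightarrow> 'a" where
  "free_gen F x = (\<lambda>w. if w = [x] then \<one>\<^bsub>F\<^esub> else \<zero>\<^bsub>F\<^esub>)"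

text \<open>
  The quotient ring together with the induced scalar multiplication, which is written as a
  union over representatives in the same way as \<^const>\<open>rcoset_mult\<close>.
\<close>

definition quotient_algebra ::
    "('a, 'b, 'm) module_scheme \<Rightarrow> 'b set \<Rightarrow> ('a, 'b set) module" where
  "quotient_algebra M I =
    ring.extend (M Quot I) \<lparr>smult = (\<lambda>c Y. \<Union>y\<in>Y. I +>\<^bsub>M\<^esub> (c \<odot>\<^bsub>M\<^esub> y))\<rparr>"

definition linear_span ::
    "('a, 'k) ring_scheme \<Rightarrow> ('a, 'b, 'm) module_scheme \<Rightarrow> 'b set \<Rightarrow> 'b set" where
  "linear_span F M S = \<Inter>{H. submodule H F M \<and> S \<subseteq> H}"


section \<open>The algebra \<open>A(d, F)\<close>\<close>

datatype idem_gen = nonstarred: Nonstarred (index: nat) | starred: Starred (index: nat)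

definition idem_gens :: "nat \<Rightarrow> idem_gen set" where
  "idem_gens d = Nonstarred ` {0..d} \<union> Starred ` {0..d}"

abbreviation free_idem_algebra ::
    "('a, 'm) ring_scheme \<Rightarrow> nat \<Rightarrow> ('a, idem_gen list \<Rightarrow> 'a) module" where
  "free_idem_algebra F d \<equiv> free_algebra F (idem_gens d)"

text \<open>
  A defining relation \<open>l = r\<close> is represented by the element \<open>l - r\<close> of the free algebra.
  The constructor \<open>g\<close> is either \<^const>\<open>Nonstarred\<close> or \<^const>\<open>Starred\<close>.
\<close>

definition idem_relators ::
    "('a, 'm) ring_scheme \<Rightarrow> nat \<Rightarrow> (nat \<Rightarrow> idem_gen) \<Rightarrow> (idem_gen list \<Rightarrow> 'a) set" where
  "idem_relators F d g =
    (let L = free_idem_algebra F d in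
      {free_gen F (g i) \<otimes>\<^bsub>L\<^esub> free_gen F (g j)
         \<ominus>\<^bsub>L\<^esub> (if i = j then free_gen F (g i) else \<zero>\<^bsub>L\<^esub>) | i j. i \<le> d \<and> j \<le> d}
      \<union> {\<one>\<^bsub>L\<^esub> \<ominus>\<^bsub>L\<^esub> (\<Oplus>\<^bsub>L\<^esub>i\<in>{0..d}. free_gen F (g i))})"

definition relation_ideal ::
    "('a, 'm) ring_scheme \<Rightarrow> nat \<Rightarrow> (idem_gen list \<Rightarrow> 'a) set" where
  "relation_ideal F d =
    Idl\<^bsub>free_idem_algebra F d\<^esub> (idem_relators F d Nonstarred \<union> idem_relators F d Starred)"

definition alg_A ::
    "('a, 'm) ring_scheme \<Rightarrow> nat \<Rightarrow> ('a, (idem_gen list \<Rightarrow> 'a) set) module" where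
  "alg_A F d = quotient_algebra (free_idem_algebra F d) (relation_ideal F d)"

definition gen_A ::
    "('a, 'm) ring_scheme \<Rightarrow> nat \<Rightarrow> idem_gen \<Rightarrow> (idem_gen list \<Rightarrow> 'a) set" where
  "gen_A F d g = relation_ideal F d +>\<^bsub>free_idem_algebra F d\<^esub> free_gen F g"


section \<open>Words and the spaces \<open>A\<^sub>n\<close>\<close>

text \<open>
  A word is given by the sequence of its letters; the corresponding element of \<open>A(d, F)\<close> is
  the product of the letters, \<open>word_value\<close>.
\<close>

definition is_word :: "nat \<Rightarrow> idem_gen list \<Rightarrow> bool" where
  "is_word d gs \<longleftrightarrow> gs \<noteq> [] \<and> set gs \<subseteq> idem_gens d
     \<and> successively (\<lambda>g h. starred g \<noteq> starred h) gs"

definition nonrepeating :: "idem_gen list \<Rightarrow> bool" where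
  "nonrepeating gs \<longleftrightarrow> successively (\<lambda>g h. index g \<noteq> index h) gs"

definition word_value ::
    "('a, 'm) ring_scheme \<Rightarrow> nat \<Rightarrow> idem_gen list \<Rightarrow> (idem_gen list \<Rightarrow> 'a) set" where
  "word_value F d gs = foldr (\<otimes>\<^bsub>alg_A F d\<^esub>) (map (gen_A F d) gs) \<one>\<^bsub>alg_A F d\<^esub>"

definition A_space ::
    "('a, 'm) ring_scheme \<Rightarrow> nat \<Rightarrow> nat \<Rightarrow> (idem_gen list \<Rightarrow> 'a) set set" where
  "A_space F d n = linear_span F (alg_A F d)
     {word_value F d gs | gs.
        is_word d gs \<and> nonrepeating gs \<and> length gs = n \<and> nonstarred (last gs)}"

text \<open>The infinite sum \<open>A\<^sub>n + A\<^sub>n\<^sub>+\<^sub>1 + \<dots>\<close> consists of the finite sums of elements of the summands.\<close>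

definition A_space_ge ::
    "('a, 'm) ring_scheme \<Rightarrow> nat \<Rightarrow> nat \<Rightarrow> (idem_gen list \<Rightarrow> 'a) set set" where
  "A_space_ge F d n =
    {\<Oplus>\<^bsub>alg_A F d\<^esub>m\<in>{n..N}. x m | N x. x \<in> (\<Pi> m\<in>{n..N}. A_space F d m)}"

end

theory Submission
  imports Defs "HOL-Algebra.UnivPoly"
begin

text \<open>
  The sum of the spaces \<open>A\<^sub>m\<close> for \<open>m \<ge> n\<close> is spanned by the nonrepeating words of length at
  least \<open>n\<close> that end with a nonstarred letter; since \<open>A\<close> is spanned by the products of its
  generators, it is enough to multiply such a word by one letter.  The product is zero, a word of
  the same kind, or a word containing equal adjacent indices.  An idempotent is \<open>1\<close> minus the
  others of its kind, and in \<open>\<dots> a b c \<dots>\<close> dropping \<open>b\<close> leaves \<open>a c = 0\<close> when \<open>a\<close> and \<open>c\<close> have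
  distinct indices.  So a single repetition can be moved to the left, modulo nonrepeating words of
  the same length, up to the front of the word, where it costs at most one letter.  When a word is
  multiplied by a starred letter on the right, a factor \<open>1 = e\<^sub>0 + \<dots> + e\<^sub>d\<close> is appended; this
  gains the length that is lost later.
\<close>

section \<open>Associative algebras and their submodules\<close>

text \<open>An associative unital algebra over the commutative ring \<open>F\<close>: the two extra
  axioms complete the bilinearity of the product.\<close>

locale assoc_algebra = module F M + M?: ring M for F and M (structure) +
  assumes smult_mult_left: "\<lbrakk>c \<in> carrier F; x \<in> carrier M; y \<in> carrier M\<rbrakk>
      \<Longrightarrow> (c \<odot> x) \<otimes> y = c \<odot> (x \<otimes> y)"
    and smult_mult_right: "\<lbrakk>c \<in> carrier F; x \<in> carrier M; y \<in> carrier M\<rbrakk>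
      \<Longrightarrow> x \<otimes> (c \<odot> y) = c \<odot> (x \<otimes> y)"

section \<open>Submodules, linear spans and infinite sums of spans\<close>

context module
begin

lemma submodule_zero: "submodule H R M \<Longrightarrow> \<zero>\<^bsub>M\<^esub> \<in> H"
  using submodule.axioms(1) subgroup.one_closed by fastforce

lemma submodule_finsum:
  assumes "submodule H R M" "f \<in> A \<rightarrow> H"
  shows "finsum M f A \<in> H"
  using assms(2)
proof (induction A rule: infinite_finite_induct)
  case (insert a A)
  have "f \<in> A \<rightarrow> carrier M" "f a \<in> carrier M"
    using insert.prems submoduleE(1)[OF assms(1)] by auto
  then show ?case
    using insert submoduleE(5)[OF assms(1)] by simp
qed (simp_all add: submodule_zero[OF assms(1)])

lemma submodule_diff:
  assumes H: "submodule H R M" and "x \<in> H" "y \<in> H"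
  shows "x \<ominus>\<^bsub>M\<^esub> y \<in> H"
  using assms submoduleE[OF H] by (simp add: a_minus_def)

lemma linear_span_submodule:
  assumes "S \<subseteq> carrier M"
  shows "submodule (linear_span R M S) R M"
proof (rule submoduleI)
  show "linear_span R M S \<subseteq> carrier M"
    unfolding linear_span_def using assms carrier_is_submodule by blast
qed (auto simp: linear_span_def submodule_zero dest: submoduleE(3,4,5))

lemma linear_span_minimal: "\<lbrakk>submodule H R M; S \<subseteq> H\<rbrakk> \<Longrightarrow> linear_span R M S \<subseteq> H"
  unfolding linear_span_def by blast

lemma linear_span_superset: "S \<subseteq> linear_span R M S"
  unfolding linear_span_def by blast

text \<open>Turns a sum of infinitely many spans into one span, so that closure under multiplication
  can later be checked on spanning elements. The finite sums form a submodule because any two of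
  them can be brought to a common upper bound.\<close>

lemma sum_of_spans_eq:
  fixes n :: nat
  assumes S: "\<And>m. S m \<subseteq> carrier M"
  shows "{\<Oplus>\<^bsub>M\<^esub>m\<in>{n..N}. x m | N x. x \<in> (\<Pi> m\<in>{n..N}. linear_span R M (S m))}
    = linear_span R M (\<Union>m\<in>{n..}. S m)" (is "?L = ?R")
proof
  note span = linear_span_submodule[OF S] and spanE = submoduleE[OF linear_span_submodule[OF S]]
  have carr: "x \<in> {n..N} \<rightarrow> carrier M"
    if "x \<in> (\<Pi> m\<in>{n..N}. linear_span R M (S m))" for x N
    using that spanE(1) by blast
  have R: "submodule ?R R M"
    by (rule linear_span_submodule) (use S in blast)
  have sub: "linear_span R M (S m) \<subseteq> ?R" if "m \<ge> n" for m
    by (rule linear_span_minimal[OF R]) (use that linear_span_superset in force)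
  show "?L \<subseteq> ?R"
  proof clarify
    fix N x assume x: "x \<in> (\<Pi> m\<in>{n..N}. linear_span R M (S m))"
    show "(\<Oplus>\<^bsub>M\<^esub>m\<in>{n..N}. x m) \<in> ?R"
      by (rule submodule_finsum[OF R]) (use x sub in force)
  qed
  \<comment> \<open>Two sums may stop at different bounds; zero summands extend both to
    \<open>max N N'\<close>, where they are added termwise.\<close>
  have pad: "\<exists>y. y \<in> (\<Pi> m\<in>{n..N'}. linear_span R M (S m)) \<and>
      (\<Oplus>\<^bsub>M\<^esub>m\<in>{n..N}. x m) = (\<Oplus>\<^bsub>M\<^esub>m\<in>{n..N'}. y m)"
    if "x \<in> (\<Pi> m\<in>{n..N}. linear_span R M (S m))" "N \<le> N'" for x N N'
  proof (intro exI conjI)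
    let ?y = "\<lambda>m. if m \<le> N then x m else \<zero>\<^bsub>M\<^esub>"
    show y: "?y \<in> (\<Pi> m\<in>{n..N'}. linear_span R M (S m))"
      using that submodule_zero[OF span] by auto
    show "(\<Oplus>\<^bsub>M\<^esub>m\<in>{n..N}. x m) = (\<Oplus>\<^bsub>M\<^esub>m\<in>{n..N'}. ?y m)"
      by (rule M.add.finprod_mono_neutral_cong_left)
        (use that(2) carr[OF y] in auto)
  qed
  have L: "submodule ?L R M"
  proof (rule submoduleI)
    show "?L \<subseteq> carrier M"
      using carr by (auto intro!: M.finsum_closed)
    show "\<zero>\<^bsub>M\<^esub> \<in> ?L"
      by (rule CollectI, rule exI[of _ n], rule exI[of _ "\<lambda>_. \<zero>\<^bsub>M\<^esub>"])
        (simp add: submodule_zero[OF span])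
    show smult: "c \<odot>\<^bsub>M\<^esub> a \<in> ?L" if "c \<in> carrier R" "a \<in> ?L" for c a
    proof -
      from that(2) obtain x N where x: "x \<in> (\<Pi> m\<in>{n..N}. linear_span R M (S m))"
        and a: "a = (\<Oplus>\<^bsub>M\<^esub>m\<in>{n..N}. x m)" by blast
      have "c \<odot>\<^bsub>M\<^esub> a = (\<Oplus>\<^bsub>M\<^esub>m\<in>{n..N}. c \<odot>\<^bsub>M\<^esub> x m)"
        unfolding a using that(1) carr[OF x] by (intro finsum_smult_ldistr) auto
      moreover have "(\<lambda>m. c \<odot>\<^bsub>M\<^esub> x m) \<in> (\<Pi> m\<in>{n..N}. linear_span R M (S m))"
        using x that(1) spanE(4) by auto
      ultimately show ?thesis by blast
    qed
    show "a \<oplus>\<^bsub>M\<^esub> b \<in> ?L" if "a \<in> ?L" "b \<in> ?L" for a b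
    proof -
      from that obtain x N y N' where
        "x \<in> (\<Pi> m\<in>{n..N}. linear_span R M (S m))" "a = (\<Oplus>\<^bsub>M\<^esub>m\<in>{n..N}. x m)"
        "y \<in> (\<Pi> m\<in>{n..N'}. linear_span R M (S m))" "b = (\<Oplus>\<^bsub>M\<^esub>m\<in>{n..N'}. y m)" by blast
      with pad[of x N "max N N'"] pad[of y N' "max N N'"] obtain x' y' where
        x': "x' \<in> (\<Pi> m\<in>{n..max N N'}. linear_span R M (S m))"
            "a = (\<Oplus>\<^bsub>M\<^esub>m\<in>{n..max N N'}. x' m)" and
        y': "y' \<in> (\<Pi> m\<in>{n..max N N'}. linear_span R M (S m))"
            "b = (\<Oplus>\<^bsub>M\<^esub>m\<in>{n..max N N'}. y' m)"
        by auto
      have "a \<oplus>\<^bsub>M\<^esub> b = (\<Oplus>\<^bsub>M\<^esub>m\<in>{n..max N N'}. x' m \<oplus>\<^bsub>M\<^esub> y' m)"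
        using x' y' carr by (simp only: M.finsum_addf)
      moreover have "(\<lambda>m. x' m \<oplus>\<^bsub>M\<^esub> y' m) \<in> (\<Pi> m\<in>{n..max N N'}. linear_span R M (S m))"
        by (intro Pi_I spanE(5)) (use x' y' in blast)+
      ultimately show ?thesis by blast
    qed
    show "\<ominus>\<^bsub>M\<^esub> a \<in> ?L" if "a \<in> ?L" for a
    proof -
      have "a \<in> carrier M" using that carr by (auto intro!: M.finsum_closed)
      then have "\<ominus>\<^bsub>M\<^esub> a = (\<ominus>\<^bsub>R\<^esub> \<one>\<^bsub>R\<^esub>) \<odot>\<^bsub>M\<^esub> a" by (simp add: smult_l_minus)
      then show ?thesis using smult[OF _ that] by simp
    qed
  qed
  show "?R \<subseteq> ?L"
  proof (rule linear_span_minimal[OF L], rule subsetI)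
    fix s assume "s \<in> (\<Union>m\<in>{n..}. S m)"
    then obtain m where m: "n \<le> m" and s: "s \<in> S m" by auto
    let ?x = "\<lambda>k. if k = m then s else \<zero>\<^bsub>M\<^esub>"
    have "s \<in> carrier M" using s S by blast
    then have "s = (\<Oplus>\<^bsub>M\<^esub>k\<in>{n..m}. ?x k)"
      using m M.add.finprod_singleton_swap[of m "{n..m}" "\<lambda>_. s"] by auto
    moreover have "?x \<in> (\<Pi> k\<in>{n..m}. linear_span R M (S k))"
      using s linear_span_superset[of "S m"] submodule_zero[OF span] by auto
    ultimately show "s \<in> ?L" by blast
  qed
qed

end

section \<open>The quotient of an algebra by a two-sided ideal\<close>

lemma ring_extend_simps [simp]:
  "carrier (ring.extend Q Z) = carrier Q" "mult (ring.extend Q Z) = mult Q"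
  "one (ring.extend Q Z) = one Q" "add (ring.extend Q Z) = add Q" "zero (ring.extend Q Z) = zero Q"
  by (simp_all add: ring.extend_def)

lemma ring_extend:
  assumes "ring Q"
  shows "ring (ring.extend Q Z)"
proof -
  interpret Q: ring Q by fact
  show ?thesis
    by (intro ringI abelian_groupI monoidI)
      (auto simp: Q.a_ac Q.m_assoc Q.l_distr Q.r_distr intro: Q.a_inv_closed Q.l_neg)
qed

lemma quotient_algebra_simps:
  "carrier (quotient_algebra M I) = carrier (M Quot I)"
  "mult (quotient_algebra M I) = mult (M Quot I)"
  "one (quotient_algebra M I) = one (M Quot I)"
  "add (quotient_algebra M I) = add (M Quot I)"
  "zero (quotient_algebra M I) = zero (M Quot I)"
  unfolding quotient_algebra_def by simp_all

context assoc_algebra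
begin

context
  fixes I assumes I: "ideal I M"
begin

interpretation I: ideal I M by (rule I)

abbreviation (input) "quot \<equiv> quotient_algebra M I"

text \<open>An ideal is defined by the ring structure alone, but it absorbs scalars because
  \<open>c \<odot> x\<close> is a product with \<open>c \<odot> \<one>\<close>.\<close>

lemma ideal_smult_closed:
  assumes "c \<in> carrier F" "x \<in> I" shows "c \<odot> x \<in> I"
proof -
  have "c \<odot> x = (c \<odot> \<one>) \<otimes> x"
    using assms I.a_Hcarr by (simp add: smult_mult_left)
  then show ?thesis using assms I.I_l_closed by simp
qed

lemma quotient_carrier: "carrier quot = (\<lambda>x. I +> x) ` carrier M"
  by (auto simp: quotient_algebra_simps FactRing_def A_RCOSETS_defs a_r_coset_defs)

lemma coset_in_quotient [simp]: "x \<in> carrier M \<Longrightarrow> I +> x \<in> carrier quot"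
  by (simp add: quotient_carrier)

lemma quotient_add:
  "\<lbrakk>x \<in> carrier M; y \<in> carrier M\<rbrakk> \<Longrightarrow> (I +> x) \<oplus>\<^bsub>quot\<^esub> (I +> y) = I +> (x \<oplus> y)"
  by (simp add: quotient_algebra_simps FactRing_def I.a_rcos_sum)

lemma quotient_mult:
  "\<lbrakk>x \<in> carrier M; y \<in> carrier M\<rbrakk> \<Longrightarrow> (I +> x) \<otimes>\<^bsub>quot\<^esub> (I +> y) = I +> (x \<otimes> y)"
  by (simp add: quotient_algebra_simps FactRing_def I.rcoset_mult_add)

lemma quotient_one: "\<one>\<^bsub>quot\<^esub> = I +> \<one>"
  by (simp add: quotient_algebra_simps FactRing_def)

lemma coset_eqI:
  assumes "x \<in> carrier M" "y \<in> carrier M" "x \<ominus> y \<in> I"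
  shows "I +> x = I +> y"
  using assms M.quotient_eq_iff_same_a_r_cos[OF I] by metis

text \<open>Two representatives differ by some \<open>h \<in> I\<close>, and
  \<open>c \<odot> h\<close> lies in \<open>I\<close> again. So the union in
  \<open>quotient_algebra\<close> is taken over equal cosets.\<close>

lemma quotient_smult:
  assumes c: "c \<in> carrier F" and x: "x \<in> carrier M"
  shows "c \<odot>\<^bsub>quot\<^esub> (I +> x) = I +> (c \<odot> x)"
proof -
  have "I +> (c \<odot> y) = I +> (c \<odot> x)" if "y \<in> I +> x" for y
  proof -
    from that obtain h where h: "h \<in> I" "y = h \<oplus> x" by (auto simp: a_r_coset_def')
    have hc: "h \<in> carrier M" using h I.a_Hcarr by blast
    have "c \<odot> y \<ominus> c \<odot> x = c \<odot> h \<oplus> c \<odot> x \<ominus> c \<odot> x"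
      using c x hc by (simp add: h smult_r_distr)
    also have "\<dots> = c \<odot> h"
      using c x hc by (simp add: M.minus_eq M.a_assoc M.r_neg)
    finally have "c \<odot> y \<ominus> c \<odot> x \<in> I"
      using ideal_smult_closed[OF c h(1)] by simp
    then show ?thesis using c x hc h by (intro coset_eqI) auto
  qed
  \<comment> \<open>The coset is nonempty, so the union of these equal sets is that set and not
    empty.\<close>
  moreover have "x \<in> I +> x" using I.a_rcos_self[OF x] .
  ultimately have "(\<Union>y\<in>I +> x. I +> (c \<odot> y)) = I +> (c \<odot> x)" by blast
  then show ?thesis
    by (simp add: quotient_algebra_def ring.extend_def)
qed

lemma quotient_ring: "ring quot"
  unfolding quotient_algebra_def by (rule ring_extend) (rule I.quotient_is_ring)

lemma quotient_assoc_algebra: "assoc_algebra F quot"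
proof -
  interpret Q: ring quot by (rule quotient_ring)
  have "module F quot"
    by (rule moduleI)
      (auto simp: quotient_carrier quotient_add quotient_smult smult_l_distr smult_r_distr
        smult_assoc1 Q.abelian_group_axioms R.cring_axioms)
  then show ?thesis
    by (intro assoc_algebra.intro assoc_algebra_axioms.intro quotient_ring)
      (auto simp: quotient_carrier quotient_mult quotient_smult smult_mult_left smult_mult_right)
qed

lemma coset_ring_hom: "ring_hom_ring M quot (\<lambda>x. I +> x)"
  by (intro ring_hom_ringI quotient_ring M.ring_axioms)
    (simp_all add: quotient_add quotient_mult quotient_one)

end

end

section \<open>The free algebra\<close>

lemma free_algebra_simps:
  "one (free_algebra F S) = (\<lambda>w. if w = [] then \<one>\<^bsub>F\<^esub> else \<zero>\<^bsub>F\<^esub>)"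
  "zero (free_algebra F S) = (\<lambda>w. \<zero>\<^bsub>F\<^esub>)"
  "add (free_algebra F S) = (\<lambda>f g w. f w \<oplus>\<^bsub>F\<^esub> g w)"
  "smult (free_algebra F S) = (\<lambda>c f w. c \<otimes>\<^bsub>F\<^esub> f w)"
  by (simp_all add: free_algebra_def)

lemma free_algebra_carrier:
  "f \<in> carrier (free_algebra F S) \<longleftrightarrow>
    (\<forall>w. f w \<in> carrier F) \<and> finite {w. f w \<noteq> \<zero>\<^bsub>F\<^esub>} \<and> (\<forall>w. f w \<noteq> \<zero>\<^bsub>F\<^esub> \<longrightarrow> set w \<subseteq> S)"
  by (simp add: free_algebra_def)

text \<open>The basis vector of the word \<open>u\<close>. It covers both the unit, for the empty
  word, and \<open>free_gen\<close>, for a word of one letter.\<close>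

definition monomial :: "('a, 'm) ring_scheme \<Rightarrow> 'g list \<Rightarrow> 'g list \<Rightarrow> 'a" where
  "monomial F u = (\<lambda>w. if w = u then \<one>\<^bsub>F\<^esub> else \<zero>\<^bsub>F\<^esub>)"

section \<open>Convolution of ring-valued functions on words\<close>

context cring
begin

lemma monomial_closed [simp]: "monomial R u w \<in> carrier R"
  by (simp add: monomial_def)

text \<open>The product of \<open>free_algebra\<close>, separated from the support conditions: the
  identities below only need values in the ring, so they also apply to shifted functions such as
  \<open>\<lambda>v. f (a # v)\<close>.\<close>

definition conv :: "('g list \<Rightarrow> 'a) \<Rightarrow> ('g list \<Rightarrow> 'a) \<Rightarrow> 'g list \<Rightarrow> 'a" where
  "conv f g w = (\<Oplus>i\<in>{..length w}. f (take i w) \<otimes> g (drop i w))"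

lemma conv_closed:
  assumes "\<And>w. f w \<in> carrier R" "\<And>w. g w \<in> carrier R"
  shows "conv f g w \<in> carrier R"
  unfolding conv_def using assms by simp

text \<open>Recursion on the first letter turns the identities for the convolution, associativity in
  particular, into inductions on the word, without any exchange of summations.\<close>

lemma conv_Nil:
  assumes "\<And>w. f w \<in> carrier R" "\<And>w. g w \<in> carrier R"
  shows "conv f g [] = f [] \<otimes> g []"
  unfolding conv_def using assms by simp

text \<open>A splitting of \<open>a # w\<close> has either an empty left part or a left part that
  begins with \<open>a\<close>; the latter correspond to the splittings of \<open>w\<close>.\<close>

lemma conv_Cons:
  assumes "\<And>w. f w \<in> carrier R" "\<And>w. g w \<in> carrier R"
  shows "conv f g (a # w) = f [] \<otimes> g (a # w) \<oplus> conv (\<lambda>v. f (a # v)) g w"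
proof -
  have "conv f g (a # w) =
    (\<Oplus>i\<in>{..length w}. f (take (Suc i) (a # w)) \<otimes> g (drop (Suc i) (a # w))) \<oplus> f [] \<otimes> g (a # w)"
    unfolding conv_def length_Cons using assms by (subst finsum_Suc2) auto
  then show ?thesis
    using assms by (simp add: conv_def a_comm)
qed

lemma conv_add_left:
  assumes "\<And>w. f w \<in> carrier R" "\<And>w. f' w \<in> carrier R" "\<And>w. g w \<in> carrier R"
  shows "conv (\<lambda>v. f v \<oplus> f' v) g w = conv f g w \<oplus> conv f' g w"
  unfolding conv_def using assms by (simp add: l_distr)

lemma conv_add_right:
  assumes "\<And>w. f w \<in> carrier R" "\<And>w. g w \<in> carrier R" "\<And>w. g' w \<in> carrier R"
  shows "conv f (\<lambda>v. g v \<oplus> g' v) w = conv f g w \<oplus> conv f g' w"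
  unfolding conv_def using assms by (simp add: r_distr)

lemma conv_smult_left:
  assumes "c \<in> carrier R" "\<And>w. f w \<in> carrier R" "\<And>w. g w \<in> carrier R"
  shows "conv (\<lambda>v. c \<otimes> f v) g w = c \<otimes> conv f g w"
  unfolding conv_def using assms by (simp add: finsum_rdistr m_assoc)

lemma conv_smult_right:
  assumes "c \<in> carrier R" "\<And>w. f w \<in> carrier R" "\<And>w. g w \<in> carrier R"
  shows "conv f (\<lambda>v. c \<otimes> g v) w = c \<otimes> conv f g w"
  unfolding conv_def using assms by (simp add: finsum_rdistr m_lcomm)

lemma conv_assoc:
  assumes "\<And>w. f w \<in> carrier R" and g: "\<And>w. g w \<in> carrier R" and h: "\<And>w. h w \<in> carrier R"
  shows "conv (conv f g) h w = conv f (conv g h) w"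
  using assms(1)
proof (induction w arbitrary: f)
  case Nil
  then show ?case using g h by (simp add: conv_Nil conv_closed m_assoc)
next
  case (Cons a w)
  have f: "\<And>w. f (a # w) \<in> carrier R" using Cons.prems .
  have ga: "\<And>w. g (a # w) \<in> carrier R" using g .
  \<comment> \<open>Shifting \<open>conv f g\<close> gives a multiple of the shifted
    \<open>g\<close> plus a convolution with the shifted \<open>f\<close>. By linearity in the left
    argument the claim reduces to the induction hypothesis for the shifted \<open>f\<close>, while
    \<open>g\<close> and \<open>h\<close> stay fixed.\<close>
  have "(\<lambda>v. conv f g (a # v)) = (\<lambda>v. f [] \<otimes> g (a # v) \<oplus> conv (\<lambda>v. f (a # v)) g v)"
    using Cons.prems g by (simp add: conv_Cons)
  then have "conv (conv f g) h (a # w) = f [] \<otimes> g [] \<otimes> h (a # w)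
      \<oplus> (f [] \<otimes> conv (\<lambda>v. g (a # v)) h w \<oplus> conv (conv (\<lambda>v. f (a # v)) g) h w)"
    using Cons.prems f g ga h
    by (simp add: conv_Cons conv_Nil conv_closed conv_add_left conv_smult_left)
  also have "\<dots> = f [] \<otimes> (g [] \<otimes> h (a # w) \<oplus> conv (\<lambda>v. g (a # v)) h w)
      \<oplus> conv (\<lambda>v. f (a # v)) (conv g h) w"
    using Cons.prems f g ga h
    by (simp add: Cons.IH[of "\<lambda>v. f (a # v)"] conv_closed r_distr m_assoc a_assoc)
  also have "\<dots> = conv f (conv g h) (a # w)"
    using Cons.prems g h by (simp add: conv_Cons conv_closed)
  finally show ?case .
qed

text \<open>The shifted monomial is \<open>monomial R u\<close> or zero, so \<open>conv_Cons\<close>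
  becomes a letter-by-letter comparison.\<close>

lemma conv_monomial_Cons:
  assumes "\<And>w. g w \<in> carrier R"
  shows "conv (monomial R (a # u)) g (b # w) = (if a = b then conv (monomial R u) g w else \<zero>)"
proof -
  have "(\<lambda>v. monomial R (a # u) (b # v)) = (if a = b then monomial R u else (\<lambda>_. \<zero>))"
    by (auto simp: monomial_def)
  moreover have "conv (\<lambda>_. \<zero>) g w = \<zero>"
    using assms by (simp add: conv_def)
  moreover have "conv (monomial R u) g w \<in> carrier R"
    using assms by (intro conv_closed) simp_all
  ultimately show ?thesis
    using assms by (simp add: conv_Cons) (simp add: monomial_def)
qed

lemma conv_one_left:
  assumes "\<And>w. g w \<in> carrier R"
  shows "conv (monomial R []) g w = g w"
proof -
  have "(\<lambda>v. monomial R [] (a # v)) = (\<lambda>_. \<zero>)" for a by (auto simp: monomial_def)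
  moreover have "conv (\<lambda>_. \<zero>) g w = \<zero>" for w
    using assms by (simp add: conv_def)
  ultimately show ?thesis
    using assms by (cases w) (simp_all add: conv_Nil conv_Cons monomial_def)
qed

lemma conv_one_right:
  assumes "\<And>w. f w \<in> carrier R"
  shows "conv f (monomial R []) w = f w"
  using assms
proof (induction w arbitrary: f)
  case Nil
  then show ?case by (simp add: conv_Nil) (simp add: monomial_def)
next
  case (Cons a w)
  then show ?case by (simp add: conv_Cons) (simp add: monomial_def)
qed

lemma conv_monomial:
  "conv (monomial R u) (monomial R v) = monomial R (u @ v)"
proof
  show "conv (monomial R u) (monomial R v) w = monomial R (u @ v) w" for w
  proof (induction u arbitrary: w)
    case Nil
    then show ?case by (simp add: conv_one_left)
  next
    case (Cons a u)
    show ?case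
    proof (cases w)
      case Nil
      then show ?thesis by (simp add: conv_Nil) (simp add: monomial_def)
    next
      case (Cons b w')
      then show ?thesis by (simp add: conv_monomial_Cons Cons.IH) (simp add: monomial_def)
    qed
  qed
qed

text \<open>Controls the support of a product: it consists of concatenations of words from the two
  supports, hence is finite and uses only letters of \<open>S\<close> if they do.\<close>

lemma conv_nonzero:
  assumes "\<And>w. f w \<in> carrier R" "\<And>w. g w \<in> carrier R" "conv f g w \<noteq> \<zero>"
  obtains u v where "w = u @ v" "f u \<noteq> \<zero>" "g v \<noteq> \<zero>"
proof -
  have "\<exists>i. f (take i w) \<noteq> \<zero> \<and> g (drop i w) \<noteq> \<zero>"
  proof (rule ccontr)
    assume "\<nexists>i. f (take i w) \<noteq> \<zero> \<and> g (drop i w) \<noteq> \<zero>"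
    then have "f (take i w) \<otimes> g (drop i w) = \<zero>" for i
      using assms(1,2) by (metis l_null r_null)
    then show False using assms(3) by (simp add: conv_def)
  qed
  then show thesis using that by (metis append_take_drop_id)
qed

section \<open>The free algebra is an associative algebra spanned by the monomials\<close>

abbreviation (input) "free S \<equiv> free_algebra R S"

lemma free_mult: "f \<otimes>\<^bsub>free S\<^esub> g = conv f g"
  by (simp add: free_algebra_def conv_def fun_eq_iff)

lemma free_mult_closed:
  assumes "f \<in> carrier (free S)" "g \<in> carrier (free S)"
  shows "conv f g \<in> carrier (free S)"
proof -
  have fg: "\<And>w. f w \<in> carrier R" "\<And>w. g w \<in> carrier R"
    using assms by (auto simp: free_algebra_carrier)
  have "{w. conv f g w \<noteq> \<zero>} \<subseteq> (\<lambda>(u, v). u @ v) ` ({w. f w \<noteq> \<zero>} \<times> {w. g w \<noteq> \<zero>})"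
    by (auto elim!: conv_nonzero[OF fg])
  moreover have "finite ((\<lambda>(u, v). u @ v) ` ({w. f w \<noteq> \<zero>} \<times> {w. g w \<noteq> \<zero>}))"
    using assms by (auto simp: free_algebra_carrier)
  ultimately have "finite {w. conv f g w \<noteq> \<zero>}" by (rule finite_subset)
  moreover have "set w \<subseteq> S" if "conv f g w \<noteq> \<zero>" for w
    using conv_nonzero[OF fg that] assms unfolding free_algebra_carrier by (metis Un_least set_append)
  moreover have "conv f g w \<in> carrier R" for w by (rule conv_closed[OF fg])
  ultimately show ?thesis by (simp add: free_algebra_carrier)
qed

lemma free_add_closed:
  assumes "f \<in> carrier (free S)" "g \<in> carrier (free S)"
  shows "(\<lambda>w. f w \<oplus> g w) \<in> carrier (free S)"
proof -
  have "{w. f w \<oplus> g w \<noteq> \<zero>} \<subseteq> {w. f w \<noteq> \<zero>} \<union> {w. g w \<noteq> \<zero>}" by auto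
  then have "finite {w. f w \<oplus> g w \<noteq> \<zero>}"
    using assms by (elim finite_subset) (simp add: free_algebra_carrier)
  then show ?thesis using assms unfolding free_algebra_carrier by (metis a_closed l_zero)
qed

lemma free_smult_closed:
  assumes "c \<in> carrier R" "f \<in> carrier (free S)"
  shows "(\<lambda>w. c \<otimes> f w) \<in> carrier (free S)"
proof -
  have "{w. c \<otimes> f w \<noteq> \<zero>} \<subseteq> {w. f w \<noteq> \<zero>}" using assms by auto
  then have "finite {w. c \<otimes> f w \<noteq> \<zero>}"
    using assms by (elim finite_subset) (simp add: free_algebra_carrier)
  then show ?thesis using assms unfolding free_algebra_carrier by (metis m_closed r_null)
qed

lemma monomial_in_free: "set u \<subseteq> S \<Longrightarrow> monomial R u \<in> carrier (free S)"
  by (simp add: free_algebra_carrier monomial_def)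

lemma free_abelian_group: "abelian_group (free S)"
proof (rule abelian_groupI)
  fix f assume f: "f \<in> carrier (free S)"
  have "(\<lambda>w. (\<ominus> \<one>) \<otimes> f w) \<oplus>\<^bsub>free S\<^esub> f = \<zero>\<^bsub>free S\<^esub>"
    using f by (auto simp: free_algebra_simps free_algebra_carrier l_minus l_neg)
  then show "\<exists>g\<in>carrier (free S). g \<oplus>\<^bsub>free S\<^esub> f = \<zero>\<^bsub>free S\<^esub>"
    using free_smult_closed[OF _ f, of "\<ominus> \<one>"] by blast
qed (auto simp: free_algebra_simps free_add_closed, auto simp: free_algebra_carrier a_ac)

lemma free_ring: "ring (free S)"
proof (rule ringI[OF free_abelian_group])
  have one: "\<one>\<^bsub>free S\<^esub> = monomial R []"
    by (simp add: free_algebra_simps monomial_def)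
  show "Group.monoid (free S)"
    by (rule monoidI)
      (auto simp: free_mult free_mult_closed one monomial_in_free,
       auto simp: free_algebra_carrier conv_assoc conv_one_left conv_one_right)
qed (auto simp: free_mult free_algebra_simps, auto simp: free_algebra_carrier conv_add_left conv_add_right)

lemma free_assoc_algebra: "assoc_algebra R (free S)"
proof -
  have "module R (free S)"
    by (rule moduleI[OF cring_axioms free_abelian_group])
      (auto simp: free_algebra_simps free_smult_closed,
       auto simp: free_algebra_carrier l_distr r_distr m_assoc)
  then show ?thesis
    by (intro assoc_algebra.intro assoc_algebra_axioms.intro free_ring)
      (auto simp: free_mult free_algebra_simps,
       auto simp: free_algebra_carrier conv_smult_left conv_smult_right)
qed

lemma free_algebra_spanned_by_monomials:
  assumes H: "submodule H R (free S)" and m: "\<And>u. set u \<subseteq> S \<Longrightarrow> monomial R u \<in> H"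
  shows "carrier (free S) \<subseteq> H"
proof
  interpret L: assoc_algebra R "free S" by (rule free_assoc_algebra)
  fix f assume "f \<in> carrier (free S)"
  moreover have "finite {w. f w \<noteq> \<zero>}" using calculation by (simp add: free_algebra_carrier)
  \<comment> \<open>Induction on the support. The function is quantified inside because the
    induction step passes to \<open>g\<close>, which is \<open>f\<close> with the coefficient at one
    word erased.\<close>
  moreover have "\<And>f. {w. f w \<noteq> \<zero>} = A \<Longrightarrow> f \<in> carrier (free S) \<Longrightarrow> f \<in> H"
    if "finite A" for A :: "'c list set"
    using that
  proof induction
    case empty
    then have "f = \<zero>\<^bsub>free S\<^esub>" by (auto simp: free_algebra_simps)
    then show ?case using L.submodule_zero[OF H] by simp
  next
    case (insert u A)
    define g where "g = (\<lambda>w. if w = u then \<zero> else f w)"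
    have supp: "{w. g w \<noteq> \<zero>} = A" using insert unfolding g_def by auto
    have fu: "f u \<in> carrier R" "set u \<subseteq> S"
      using insert.prems unfolding free_algebra_carrier by auto
    have "g \<in> carrier (free S)"
      unfolding free_algebra_carrier supp
      using insert.hyps insert.prems(2) by (auto simp: g_def free_algebra_carrier)
    then have "g \<in> H" using insert.IH supp by blast
    moreover have "f u \<odot>\<^bsub>free S\<^esub> monomial R u \<in> H"
      using fu m L.submoduleE(4)[OF H] by blast
    ultimately have "f u \<odot>\<^bsub>free S\<^esub> monomial R u \<oplus>\<^bsub>free S\<^esub> g \<in> H"
      using L.submoduleE(5)[OF H] by blast
    moreover have "f u \<odot>\<^bsub>free S\<^esub> monomial R u \<oplus>\<^bsub>free S\<^esub> g = f"
      using insert.prems(2) fu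
      by (auto simp: free_algebra_simps free_algebra_carrier monomial_def g_def)
    ultimately show ?case by simp
  qed
  ultimately show "f \<in> H" by blast
qed

end

section \<open>Nonrepeating words in an algebra with two families of idempotents\<close>

text \<open>Makes the kind of a generator a Boolean parameter, so that one argument serves the
  starred and the nonstarred family.\<close>

definition letter :: "bool \<Rightarrow> nat \<Rightarrow> idem_gen" where
  "letter b i = (if b then Starred i else Nonstarred i)"

lemma letter_simps [simp]:
  "starred (letter b i) = b" "index (letter b i) = i" "letter (starred g) (index g) = g"
  "letter b i \<in> idem_gens d \<longleftrightarrow> i \<le> d" "nonstarred g \<longleftrightarrow> \<not> starred g"
  by (cases g; auto simp: letter_def idem_gens_def)+

lemma idem_gens_index: "g \<in> idem_gens d \<Longrightarrow> index g \<le> d"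
  by (auto simp: idem_gens_def)

lemma idem_gen_eqI: "\<lbrakk>starred g = starred h; index g = index h\<rbrakk> \<Longrightarrow> g = h"
  by (cases g; cases h) auto

definition nr_step :: "idem_gen \<Rightarrow> idem_gen \<Rightarrow> bool" where
  "nr_step g h \<longleftrightarrow> starred g \<noteq> starred h \<and> index g \<noteq> index h"

text \<open>The length is only bounded below: these words are to span the whole sum of the spaces
  \<open>A_space F d m\<close> with \<open>m \<ge> n\<close>, and multiplication may lengthen a
  word.\<close>

definition nr_words :: "nat \<Rightarrow> nat \<Rightarrow> idem_gen list set" where
  "nr_words d n = {gs. gs \<noteq> [] \<and> set gs \<subseteq> idem_gens d \<and> successively nr_step gs
     \<and> n \<le> length gs \<and> \<not> starred (last gs)}"

lemma nr_words_iff: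
  "gs \<in> nr_words d n \<longleftrightarrow>
    is_word d gs \<and> nonrepeating gs \<and> n \<le> length gs \<and> nonstarred (last gs)"
  by (auto simp: nr_words_def is_word_def nonrepeating_def nr_step_def successively_conv_nth)

text \<open>Separates the defining relations from the presentation. The rewriting of words uses the
  relations alone; that the letters generate the algebra is a hypothesis of
  \<open>nr_span_ideal\<close>.\<close>

locale idempotent_algebra = assoc_algebra F M for F and M (structure) +
  fixes d :: nat and e :: "idem_gen \<Rightarrow> 'c"
  assumes e_closed [simp]: "g \<in> idem_gens d \<Longrightarrow> e g \<in> carrier M"
    and e_mult: "\<lbrakk>g \<in> idem_gens d; h \<in> idem_gens d; starred g = starred h\<rbrakk>
      \<Longrightarrow> e g \<otimes> e h = (if g = h then e g else \<zero>)"
    and e_sum: "(\<Oplus>k\<in>{0..d}. e (letter b k)) = \<one>"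
begin

definition val :: "idem_gen list \<Rightarrow> 'c" where
  "val gs = foldr (\<otimes>) (map e gs) \<one>"

lemma val_simps [simp]: "val [] = \<one>" "val (g # gs) = e g \<otimes> val gs"
  by (simp_all add: val_def)

lemma val_closed [simp]: "set gs \<subseteq> idem_gens d \<Longrightarrow> val gs \<in> carrier M"
  by (induction gs) auto

lemma val_append:
  "\<lbrakk>set gs \<subseteq> idem_gens d; set hs \<subseteq> idem_gens d\<rbrakk> \<Longrightarrow> val (gs @ hs) = val gs \<otimes> val hs"
  by (induction gs) (auto simp: m_assoc)

lemma insert_idempotents:
  assumes "x \<in> carrier M" "y \<in> carrier M"
  shows "x \<otimes> y = (\<Oplus>k\<in>{0..d}. x \<otimes> e (letter b k) \<otimes> y)"
proof -
  have e: "(\<lambda>k. e (letter b k)) \<in> {0..d} \<rightarrow> carrier M" by auto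
  have "x \<otimes> y = x \<otimes> (\<Oplus>k\<in>{0..d}. e (letter b k)) \<otimes> y"
    using assms by (simp add: e_sum)
  also have "x \<otimes> (\<Oplus>k\<in>{0..d}. e (letter b k)) = (\<Oplus>k\<in>{0..d}. x \<otimes> e (letter b k))"
    using assms e by (simp add: finsum_rdistr)
  also have "\<dots> \<otimes> y = (\<Oplus>k\<in>{0..d}. x \<otimes> e (letter b k) \<otimes> y)"
    using assms e by (intro finsum_ldistr) auto
  finally show ?thesis .
qed

text \<open>The idempotents of one kind sum to \<open>1\<close>, so one of them is \<open>1\<close> minus the others.\<close>

lemma replace_idempotent:
  assumes H: "submodule H F M" and x: "x \<in> carrier M" and y: "y \<in> carrier M" and i: "i \<le> d"
    and xy: "x \<otimes> y \<in> H"
    and others: "\<And>k. \<lbrakk>k \<le> d; k \<noteq> i\<rbrakk> \<Longrightarrow> x \<otimes> e (letter b k) \<otimes> y \<in> H"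
  shows "x \<otimes> e (letter b i) \<otimes> y \<in> H"
proof -
  let ?f = "\<lambda>k. x \<otimes> e (letter b k) \<otimes> y"
  have f: "?f k \<in> carrier M" if "k \<le> d" for k using that x y by simp
  let ?s = "finsum M ?f ({0..d} - {i})"
  have s: "?s \<in> H" by (rule submodule_finsum[OF H]) (use others in auto)
  then have sc: "?s \<in> carrier M" using submoduleE(1)[OF H] by blast
  have "x \<otimes> y = finsum M ?f (insert i ({0..d} - {i}))"
    using i insert_idempotents[OF x y, of b] by (simp add: insert_absorb)
  also have "\<dots> = ?f i \<oplus> ?s"
    using f i by (intro finsum_insert) auto
  finally have "?f i = x \<otimes> y \<ominus> ?s"
    using f[OF i] sc by (simp add: minus_eq a_assoc r_neg)
  then show ?thesis using submodule_diff[OF H xy s] by simp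
qed

section \<open>The span of the long nonrepeating words and the removal of a repetition\<close>

abbreviation nr_span :: "nat \<Rightarrow> 'c set" where
  "nr_span n \<equiv> linear_span F M (val ` nr_words d n)"

lemma val_nr_words_carrier: "val ` nr_words d n \<subseteq> carrier M"
  by (auto simp: nr_words_def)

lemmas nr_span_submodule = linear_span_submodule[OF val_nr_words_carrier]

lemma val_in_nr_span: "gs \<in> nr_words d n \<Longrightarrow> val gs \<in> nr_span n"
  using linear_span_superset by blast

text \<open>Replacing the left one of the two letters with equal index moves the repetition one step
  to the left, modulo nonrepeating words of the same length.  The length drops, by one, only when
  the repetition has reached the left end.\<close>

lemma single_repetition:
  assumes "set (u @ [g] @ h # v) \<subseteq> idem_gens d"
    and "successively nr_step (u @ [g])" "successively nr_step (h # v)"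
    and "starred g \<noteq> starred h" "index g = index h" "\<not> starred (last (h # v))"
    and "n \<le> length (u @ h # v)"
  shows "val (u @ [g] @ h # v) \<in> nr_span n"
  using assms
proof (induction u arbitrary: g h v rule: rev_induct)
  case Nil
  have v: "val (h # v) \<in> carrier M" and g: "g \<in> idem_gens d" using Nil by auto
  have "\<one> \<otimes> e (letter (starred g) (index g)) \<otimes> val (h # v) \<in> nr_span n"
  proof (rule replace_idempotent[OF nr_span_submodule _ v idem_gens_index[OF g]])
    \<comment> \<open>Deleting \<open>g\<close> leaves a nonrepeating word. It is long enough
      because the length hypothesis does not count \<open>g\<close>.\<close>
    have "h # v \<in> nr_words d n" using Nil by (auto simp: nr_words_def)
    then show "\<one> \<otimes> val (h # v) \<in> nr_span n" using v val_in_nr_span by force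
    fix k assume k: "k \<le> d" "k \<noteq> index g"
    have "letter (starred g) k # h # v \<in> nr_words d n"
      using Nil k by (auto simp: nr_words_def nr_step_def)
    then show "\<one> \<otimes> e (letter (starred g) k) \<otimes> val (h # v) \<in> nr_span n"
      using k val_in_nr_span by force
  qed simp
  then show ?case using g v by simp
next
  case (snoc a u)
  have ua: "set (u @ [a]) \<subseteq> idem_gens d" and hv: "set (h # v) \<subseteq> idem_gens d"
    and g: "g \<in> idem_gens d" using snoc.prems by auto
  have step: "successively nr_step (u @ [a])" "nr_step a g"
    using snoc.prems(2) by (auto simp: successively_append_iff)
  have word: "val ((u @ [a]) @ [c] @ h # v) = val (u @ [a]) \<otimes> e c \<otimes> val (h # v)"
    if "c \<in> idem_gens d" for c
    using that ua hv by (subst val_append) (auto simp: m_assoc)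
  have "val (u @ [a]) \<otimes> e (letter (starred g) (index g)) \<otimes> val (h # v) \<in> nr_span n"
  proof (rule replace_idempotent[OF nr_span_submodule _ _ idem_gens_index[OF g]])
    \<comment> \<open>Both \<open>a\<close> and \<open>h\<close> differ in kind from
      \<open>g\<close>, so they are of the same kind; their indices differ since
      \<open>index a \<noteq> index g = index h\<close>. Hence deleting \<open>g\<close> makes the
      product vanish.\<close>
    have "e a \<otimes> e h = \<zero>"
      using step(2) snoc.prems ua hv by (auto simp: e_mult nr_step_def)
    then have "val (u @ [a]) \<otimes> val (h # v) = \<zero>"
      using ua hv by (simp add: val_append m_assoc) (simp flip: m_assoc)
    then show "val (u @ [a]) \<otimes> val (h # v) \<in> nr_span n"
      using submodule_zero[OF nr_span_submodule] by simp
    fix k assume k: "k \<le> d" "k \<noteq> index g"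
    let ?c = "letter (starred g) k"
    have c: "?c \<in> idem_gens d" using k by simp
    have "val ((u @ [a]) @ [?c] @ h # v) \<in> nr_span n"
    \<comment> \<open>If \<open>k = index a\<close>, the repetition has moved to the pair
      \<open>a\<close>, \<open>?c\<close>, whereas \<open>?c\<close> and \<open>h\<close> differ
      because \<open>k \<noteq> index g\<close>. The induction hypothesis now discounts
      \<open>a\<close> instead of \<open>g\<close>, so its length bound is the same.\<close>
    proof (cases "k = index a")
      case True
      have "val (u @ [a] @ ?c # h # v) \<in> nr_span n"
      proof (rule snoc.IH)
        show "set (u @ [a] @ ?c # h # v) \<subseteq> idem_gens d" using ua hv c by auto
        show "successively nr_step (?c # h # v)" "\<not> starred (last (?c # h # v))"
          "n \<le> length (u @ ?c # h # v)"
          using snoc.prems k by (auto simp: nr_step_def)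
        show "starred a \<noteq> starred ?c" "index a = index ?c"
          using step(2) True by (auto simp: nr_step_def)
      qed (fact step)
      then show ?thesis by simp
    next
      case False
      have "(u @ [a]) @ [?c] @ h # v \<in> nr_words d n"
        using snoc.prems k False step ua hv
        by (auto simp: nr_words_def nr_step_def successively_append_iff)
      then show ?thesis by (rule val_in_nr_span)
    qed
    then show "val (u @ [a]) \<otimes> e ?c \<otimes> val (h # v) \<in> nr_span n"
      using word[OF c] by simp
  qed (use ua hv in auto)
  then show ?case using word[OF g] by simp
qed

section \<open>Multiplying a nonrepeating word by one letter\<close>

lemma nr_word_left_mult:
  assumes w: "w \<in> nr_words d n" and c: "c \<in> idem_gens d"
  shows "e c \<otimes> val w \<in> nr_span n"
proof -
  from w obtain a v where w_eq: "w = a # v" by (cases w) (auto simp: nr_words_def)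
  have av: "a \<in> idem_gens d" "set v \<subseteq> idem_gens d" using w by (auto simp: w_eq nr_words_def)
  consider "starred c = starred a" | "starred c \<noteq> starred a" "index c = index a"
    | "starred c \<noteq> starred a" "index c \<noteq> index a" by blast
  then show ?thesis
  proof cases
    case 1
    then have "e c \<otimes> val w = (if c = a then val w else \<zero>)"
      using c av e_mult[of c a] by (simp add: w_eq flip: m_assoc)
    then show ?thesis
      using val_in_nr_span[OF w] submodule_zero[OF nr_span_submodule] by simp
  next
    case 2
    \<comment> \<open>The repetition is already at the left end; the discounted letter is
      \<open>c\<close>, so the length bound is the one known for \<open>w\<close>.\<close>
    have "val ([] @ [c] @ a # v) \<in> nr_span n"
      by (rule single_repetition) (use 2 w c in \<open>auto simp: w_eq nr_words_def\<close>)
    then show ?thesis by (simp add: w_eq)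
  next
    case 3
    then have "c # w \<in> nr_words d n"
      using w c by (auto simp: w_eq nr_words_def nr_step_def)
    then show ?thesis using val_in_nr_span by force
  qed
qed

text \<open>Only a starred \<open>c\<close> is difficult, as the product then has the wrong last
  letter. Once \<open>letter False k\<close> is appended, the pairs that can repeat an index are
  \<open>a\<close>, \<open>c\<close> and \<open>c\<close>, \<open>letter False k\<close>; the cases
  record which of them do.\<close>

lemma nr_word_right_mult:
  assumes w: "w \<in> nr_words d n" and c: "c \<in> idem_gens d"
  shows "val w \<otimes> e c \<in> nr_span n"
proof -
  from w obtain v a where w_eq: "w = v @ [a]"
    by (cases w rule: rev_cases) (auto simp: nr_words_def)
  have av: "a \<in> idem_gens d" "set v \<subseteq> idem_gens d" "\<not> starred a"
    and wd: "set w \<subseteq> idem_gens d" using w by (auto simp: w_eq nr_words_def)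
  show ?thesis
  proof (cases "starred c")
    case False
    then have "val w \<otimes> e c = (if a = c then val w else \<zero>)"
      using c av e_mult[of a c] by (simp add: w_eq val_append m_assoc)
    then show ?thesis
      using val_in_nr_span[OF w] submodule_zero[OF nr_span_submodule] by simp
  next
    case True
    have nr: "w @ [b] @ [letter False k] \<in> nr_words d n"
      if "b \<in> idem_gens d" "starred b" "k \<le> d" "index b \<noteq> index a" "k \<noteq> index b" for b k
      using that w av by (auto simp: w_eq nr_words_def nr_step_def successively_append_iff)
    have word: "val (w @ [b] @ [letter False k]) = val w \<otimes> e b \<otimes> e (letter False k)"
      if "b \<in> idem_gens d" "k \<le> d" for b k
      using that wd by (subst val_append) (auto simp: m_assoc)
    have "val w \<otimes> e c \<otimes> e (letter False k) \<in> nr_span n" if k: "k \<le> d" for k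
    proof -
      have "val (w @ [c] @ [letter False k]) \<in> nr_span n"
      proof (cases "index c = index a")
        case False
        show ?thesis
        proof (cases "k = index c")
          case True
          show ?thesis
            by (rule single_repetition)
              (use w c k av \<open>starred c\<close> \<open>index c \<noteq> index a\<close> True in
                \<open>auto simp: w_eq nr_words_def nr_step_def successively_append_iff\<close>)
        next
          case False
          then show ?thesis
            using nr[OF c \<open>starred c\<close> k \<open>index c \<noteq> index a\<close>] val_in_nr_span by blast
        qed
      next
        case ca: True
        show ?thesis
        proof (cases "k = index c")
          case False
          have "val (v @ [a] @ c # [letter False k]) \<in> nr_span n"
            by (rule single_repetition)
              (use w c k av \<open>starred c\<close> ca False in
                \<open>auto simp: w_eq nr_words_def nr_step_def successively_append_iff\<close>)
          then show ?thesis by (simp add: w_eq)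
        next
          case True
          then have a_eq: "letter False k = a"
            using ca av by (intro idem_gen_eqI) auto
          \<comment> \<open>Here both pairs repeat, so \<open>single_repetition\<close> does not
            apply. Expanding the middle letter works directly: deleting it merges the two copies of
            \<open>a\<close> and returns \<open>w\<close>, and any other starred letter there gives
            a nonrepeating word.\<close>
          have "val w \<otimes> e (letter True (index c)) \<otimes> e (letter False k) \<in> nr_span n"
          proof (rule replace_idempotent[OF nr_span_submodule _ _ idem_gens_index[OF c]])
            have "val w \<otimes> e (letter False k) = val w"
              using av e_mult[of a a] by (simp add: a_eq w_eq val_append m_assoc)
            then show "val w \<otimes> e (letter False k) \<in> nr_span n"
              using val_in_nr_span[OF w] by simp
            fix j assume j: "j \<le> d" "j \<noteq> index c"
            then show "val w \<otimes> e (letter True j) \<otimes> e (letter False k) \<in> nr_span n"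
              using val_in_nr_span[OF nr[of "letter True j" k]] word[of "letter True j" k] k ca True
              by simp
          qed (use wd k in auto)
          moreover have "letter True (index c) = c"
            using \<open>starred c\<close> by (intro idem_gen_eqI) auto
          ultimately show ?thesis using word[OF c k] by simp
        qed
      qed
      then show ?thesis using word[OF c k] by simp
    qed
    \<comment> \<open>The trailing \<open>\<one>\<close> is the right factor in
      \<open>insert_idempotents\<close>, which appends the sum of the nonstarred
      idempotents.\<close>
    then have "(\<Oplus>k\<in>{0..d}. val w \<otimes> e c \<otimes> e (letter False k) \<otimes> \<one>) \<in> nr_span n"
      using wd c by (intro submodule_finsum[OF nr_span_submodule]) auto
    then show ?thesis
      using insert_idempotents[of "val w \<otimes> e c" \<one> False] wd c by simp
  qed
qed

section \<open>From single letters to arbitrary multipliers\<close>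

lemma generator_mult_closed:
  assumes g: "g \<in> idem_gens d" and x: "x \<in> nr_span n"
  shows "e g \<otimes> x \<in> nr_span n" "x \<otimes> e g \<in> nr_span n"
proof -
  note H = nr_span_submodule[of n]
  note HE = submoduleE[OF H] submodule_zero[OF H]
  have sub: "nr_span n \<subseteq> carrier M" by (rule HE(1))
  have eg: "e g \<in> carrier M" using g by simp
  \<comment> \<open>The elements whose products with \<open>e g\<close> stay in the span form a
    submodule, so the spanning words suffice.\<close>
  have "submodule {x \<in> nr_span n. e g \<otimes> x \<in> nr_span n \<and> x \<otimes> e g \<in> nr_span n} F M"
    by (rule submoduleI)
      (use sub eg HE in \<open>auto simp: subset_iff r_distr l_distr r_minus l_minus
         smult_mult_left smult_mult_right\<close>)
  moreover have "val ` nr_words d n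
      \<subseteq> {x \<in> nr_span n. e g \<otimes> x \<in> nr_span n \<and> x \<otimes> e g \<in> nr_span n}"
    using nr_word_left_mult[OF _ g] nr_word_right_mult[OF _ g] val_in_nr_span by blast
  ultimately have "nr_span n \<subseteq> {x \<in> nr_span n. e g \<otimes> x \<in> nr_span n \<and> x \<otimes> e g \<in> nr_span n}"
    by (rule linear_span_minimal)
  then show "e g \<otimes> x \<in> nr_span n" "x \<otimes> e g \<in> nr_span n" using x by auto
qed

text \<open>The multipliers \<open>?K\<close> that preserve the span from both sides form a
  submodule containing every product of letters. The hypothesis \<open>generated\<close> says that
  such a submodule is everything.\<close>

lemma nr_span_ideal:
  assumes generated:
    "\<And>H. \<lbrakk>submodule H F M; \<And>gs. set gs \<subseteq> idem_gens d \<Longrightarrow> val gs \<in> H\<rbrakk> \<Longrightarrow> carrier M \<subseteq> H"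
  shows "ideal (nr_span n) M"
proof -
  note H = nr_span_submodule[of n]
  note HE = submoduleE[OF H] submodule_zero[OF H]
  have sub: "nr_span n \<subseteq> carrier M" by (rule HE(1))
  let ?K = "{a \<in> carrier M. \<forall>x\<in>nr_span n. a \<otimes> x \<in> nr_span n \<and> x \<otimes> a \<in> nr_span n}"
  have "submodule ?K F M"
    by (rule submoduleI)
      (use sub HE in \<open>auto simp: subset_iff r_distr l_distr r_minus l_minus
         smult_mult_left smult_mult_right\<close>)
  moreover have "val gs \<in> ?K" if "set gs \<subseteq> idem_gens d" for gs
    using that
  proof (induction gs)
    case Nil
    then show ?case using sub by auto
  next
    case (Cons g gs)
    have "val gs \<in> carrier M" "e g \<in> carrier M" "g \<in> idem_gens d" using Cons.prems by auto
    moreover have "e g \<otimes> (val gs \<otimes> x) \<in> nr_span n" "x \<otimes> e g \<otimes> val gs \<in> nr_span n"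
      if "x \<in> nr_span n" for x
      using Cons that generator_mult_closed[of g] by auto
    ultimately show ?case using sub by (auto simp: subset_iff m_assoc)
  qed
  ultimately have "carrier M \<subseteq> ?K" by (rule generated)
  then show ?thesis
    by (intro idealI submodule.axioms(1)[OF H] M.ring_axioms) auto
qed

end

section \<open>The algebra \<open>A(d, F)\<close>\<close>

lemma free_gen_monomial: "free_gen F g = monomial F [g]"
  by (simp add: free_gen_def monomial_def)

context cring
begin

section \<open>The relation ideal, and the relations in the quotient\<close>

abbreviation (input) "L d \<equiv> free_idem_algebra R d"

lemma free_gen_carrier [simp]: "g \<in> idem_gens d \<Longrightarrow> free_gen R g \<in> carrier (L d)"
  by (simp add: free_gen_monomial monomial_in_free)

lemma idem_relators_carrier:
  assumes "\<And>i. i \<le> d \<Longrightarrow> g i \<in> idem_gens d"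
  shows "idem_relators R d g \<subseteq> carrier (L d)"
proof -
  interpret L: ring "L d" by (rule free_ring)
  show ?thesis
    using assms by (auto simp: idem_relators_def Let_def intro!: L.minus_closed L.m_closed L.finsum_closed)
qed

lemma all_relators_carrier:
  "idem_relators R d Nonstarred \<union> idem_relators R d Starred \<subseteq> carrier (L d)"
  by (intro Un_least idem_relators_carrier) (auto simp: idem_gens_def)

lemma relation_ideal_ideal: "ideal (relation_ideal R d) (L d)"
  unfolding relation_ideal_def
  by (rule ring.genideal_ideal[OF free_ring all_relators_carrier])

lemma relators_in_relation_ideal: "idem_relators R d (letter b) \<subseteq> relation_ideal R d"
proof -
  have "letter True = Starred" "letter False = Nonstarred" by (auto simp: letter_def)
  then show ?thesis
    unfolding relation_ideal_def
    using ring.genideal_self[OF free_ring all_relators_carrier] by (cases b) auto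
qed

lemma alg_A_assoc_algebra: "assoc_algebra R (alg_A R d)"
  unfolding alg_A_def
  by (rule assoc_algebra.quotient_assoc_algebra[OF free_assoc_algebra relation_ideal_ideal])

lemma alg_A_hom: "ring_hom_ring (L d) (alg_A R d) (\<lambda>x. relation_ideal R d +>\<^bsub>L d\<^esub> x)"
  unfolding alg_A_def
  by (rule assoc_algebra.coset_ring_hom[OF free_assoc_algebra relation_ideal_ideal])

text \<open>Each relator lies in the ideal, so the two sides of its relation have the same coset;
  the coset map is a ring homomorphism and carries products and finite sums to the quotient.\<close>

lemma alg_A_idempotent_algebra: "idempotent_algebra R (alg_A R d) d (gen_A R d)"
proof -
  interpret L: assoc_algebra R "L d" by (rule free_assoc_algebra)
  interpret A: assoc_algebra R "alg_A R d" by (rule alg_A_assoc_algebra)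
  interpret hom: ring_hom_ring "L d" "alg_A R d" "\<lambda>x. relation_ideal R d +>\<^bsub>L d\<^esub> x"
    by (rule alg_A_hom)
  note coset_eqI = L.coset_eqI[OF relation_ideal_ideal]
  have gen: "gen_A R d = (\<lambda>g. relation_ideal R d +>\<^bsub>L d\<^esub> free_gen R g)"
    by (simp add: gen_A_def fun_eq_iff)
  show ?thesis
  proof
    show "gen_A R d g \<in> carrier (alg_A R d)" if "g \<in> idem_gens d" for g
      using that by (simp add: gen)
  next
    fix g h assume gh: "g \<in> idem_gens d" "h \<in> idem_gens d" "starred g = starred h"
    have "g = letter (starred g) (index g)" by simp
    moreover have "h = letter (starred g) (index h)" using gh(3) by simp
    ultimately obtain i j b where ij: "g = letter b i" "h = letter b j" "i \<le> d" "j \<le> d"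
      using gh(1,2) idem_gens_index by blast
    \<comment> \<open>The right-hand side of the relation, in the shape it has in
      \<open>idem_relators\<close>.\<close>
    let ?r = "if i = j then free_gen R (letter b i) else \<zero>\<^bsub>L d\<^esub>"
    have "free_gen R g \<otimes>\<^bsub>L d\<^esub> free_gen R h \<ominus>\<^bsub>L d\<^esub> ?r \<in> idem_relators R d (letter b)"
      unfolding idem_relators_def Let_def ij(1,2) using ij(3,4) by blast
    then have "free_gen R g \<otimes>\<^bsub>L d\<^esub> free_gen R h \<ominus>\<^bsub>L d\<^esub> ?r \<in> relation_ideal R d"
      by (rule subsetD[OF relators_in_relation_ideal])
    then have "relation_ideal R d +>\<^bsub>L d\<^esub> (free_gen R g \<otimes>\<^bsub>L d\<^esub> free_gen R h)
        = relation_ideal R d +>\<^bsub>L d\<^esub> ?r"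
      using gh ij by (intro coset_eqI) auto
    moreover have "g = h \<longleftrightarrow> i = j" using ij letter_simps(2) by metis
    ultimately show "gen_A R d g \<otimes>\<^bsub>alg_A R d\<^esub> gen_A R d h
        = (if g = h then gen_A R d g else \<zero>\<^bsub>alg_A R d\<^esub>)"
      using gh ij by (auto simp: gen)
  next
    fix b
    have f: "(\<lambda>i. free_gen R (letter b i)) \<in> {0..d} \<rightarrow> carrier (L d)" by auto
    have "\<one>\<^bsub>L d\<^esub> \<ominus>\<^bsub>L d\<^esub> (\<Oplus>\<^bsub>L d\<^esub>i\<in>{0..d}. free_gen R (letter b i)) \<in> relation_ideal R d"
      using relators_in_relation_ideal[of d b] by (auto simp: idem_relators_def Let_def)
    then have "relation_ideal R d +>\<^bsub>L d\<^esub> \<one>\<^bsub>L d\<^esub>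
        = relation_ideal R d +>\<^bsub>L d\<^esub> (\<Oplus>\<^bsub>L d\<^esub>i\<in>{0..d}. free_gen R (letter b i))"
      using f by (intro coset_eqI) auto
    then show "(\<Oplus>\<^bsub>alg_A R d\<^esub>k\<in>{0..d}. gen_A R d (letter b k)) = \<one>\<^bsub>alg_A R d\<^esub>"
      using f by (simp add: gen comp_def)
  qed
qed

section \<open>Products of generators span the quotient\<close>

lemma monomial_word_value:
  assumes "set gs \<subseteq> idem_gens d"
  shows "relation_ideal R d +>\<^bsub>L d\<^esub> monomial R gs = word_value R d gs"
proof -
  interpret hom: ring_hom_ring "L d" "alg_A R d" "\<lambda>x. relation_ideal R d +>\<^bsub>L d\<^esub> x"
    by (rule alg_A_hom)
  show ?thesis
    using assms
  proof (induction gs)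
    case Nil
    have "monomial R [] = \<one>\<^bsub>L d\<^esub>" by (simp add: free_algebra_simps monomial_def)
    then show ?case by (simp add: word_value_def)
  next
    case (Cons g gs)
    have "monomial R (g # gs) = free_gen R g \<otimes>\<^bsub>L d\<^esub> monomial R gs"
      by (simp add: free_gen_monomial free_mult conv_monomial)
    then show ?case
      using Cons by (simp add: monomial_in_free) (simp add: word_value_def gen_A_def)
  qed
qed

text \<open>The preimage \<open>?P\<close> of \<open>H\<close> under the coset map is a submodule of
  the free algebra that contains all monomials. The lists \<open>gs\<close> are arbitrary and need
  not alternate, which is the form of \<open>generated\<close> in
  \<open>nr_span_ideal\<close>.\<close>

lemma alg_A_spanned_by_words:
  assumes H: "submodule H R (alg_A R d)"
    and words: "\<And>gs. set gs \<subseteq> idem_gens d \<Longrightarrow> word_value R d gs \<in> H"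
  shows "carrier (alg_A R d) \<subseteq> H"
proof -
  interpret L: assoc_algebra R "L d" by (rule free_assoc_algebra)
  interpret A: assoc_algebra R "alg_A R d" by (rule alg_A_assoc_algebra)
  interpret hom: ring_hom_ring "L d" "alg_A R d" "\<lambda>x. relation_ideal R d +>\<^bsub>L d\<^esub> x"
    by (rule alg_A_hom)
  note HE = A.submoduleE[OF H] A.submodule_zero[OF H]
  let ?P = "{f \<in> carrier (L d). relation_ideal R d +>\<^bsub>L d\<^esub> f \<in> H}"
  have smult: "relation_ideal R d +>\<^bsub>L d\<^esub> (c \<odot>\<^bsub>L d\<^esub> x)
      = c \<odot>\<^bsub>alg_A R d\<^esub> (relation_ideal R d +>\<^bsub>L d\<^esub> x)"
    if "c \<in> carrier R" "x \<in> carrier (L d)" for c x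
    unfolding alg_A_def using L.quotient_smult[OF relation_ideal_ideal that] by simp
  have "submodule ?P R (L d)"
    by (rule L.submoduleI) (use HE in \<open>auto simp: smult\<close>)
  moreover have "monomial R gs \<in> ?P" if "set gs \<subseteq> idem_gens d" for gs
    using that words by (simp add: monomial_in_free monomial_word_value)
  ultimately have "carrier (L d) \<subseteq> ?P" by (rule free_algebra_spanned_by_monomials)
  then show ?thesis
    unfolding alg_A_def L.quotient_carrier[OF relation_ideal_ideal] by blast
qed

end

theorem theorem6p2:
  fixes F :: "('a, 'm) ring_scheme" and d n :: nat
  assumes "field F"
    and "d \<ge> 1"
    and "n \<ge> 1"
  shows "ideal (A_space_ge F d n) (alg_A F d)"
proof -
  interpret F: field F by fact
  interpret A: idempotent_algebra F "alg_A F d" d "gen_A F d"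
    by (rule F.alg_A_idempotent_algebra)
  have val: "A.val = word_value F d"
    by (simp add: A.val_def word_value_def fun_eq_iff)
  define S where "S m = {word_value F d gs | gs.
    is_word d gs \<and> nonrepeating gs \<and> length gs = m \<and> nonstarred (last gs)}" for m
  \<comment> \<open>The bound \<open>0\<close> admits words of every length; this inclusion only
    serves to place \<open>S m\<close> in the carrier.\<close>
  have "S m \<subseteq> word_value F d ` nr_words d 0" for m
    unfolding S_def by (auto simp: nr_words_iff)
  then have "S m \<subseteq> carrier (alg_A F d)" for m
    using A.val_nr_words_carrier[of 0] unfolding val by blast
  then have "A_space_ge F d n = linear_span F (alg_A F d) (\<Union>m\<in>{n..}. S m)"
    unfolding A_space_ge_def A_space_def S_def by (rule A.sum_of_spans_eq)
  \<comment> \<open>Collecting the words of each exact length \<open>m \<ge> n\<close> gives those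
    of length at least \<open>n\<close>, so the sum is the span already known to be an
    ideal.\<close>
  also have "(\<Union>m\<in>{n..}. S m) = word_value F d ` nr_words d n"
    unfolding S_def by (fastforce simp: nr_words_iff)
  finally show ?thesis
    using A.nr_span_ideal[of n] F.alg_A_spanned_by_words unfolding val by simp
qed

end
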